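(* Let $f\colon\mathbb{R}^d\to\mathbb{R}$ be a differentiable convex function attaining its minimum value $f^\star$ at $x^\star$, and let $\overline{\nabla} f$ be a weak discrete gradient of $f$ with parameters $(\alpha,\beta,\gamma)$ such that $\beta\ge 0$ and $\gamma\ge 0$. Let $h>0$, $x_0\in\mathbb{R}^d$, and let $(x^{(k)})_{k\ge 0}$ be a sequence in $\mathbb{R}^d$ satisfying $x^{(0)}=x_0$ and $$\frac{x^{(k+1)}-x^{(k)}}{h}=-\overline{\nabla} f\left(x^{(k+1)},x^{(k)}\right)\qquad (k\ge 0).$$ If $h\le\frac{1}{2\alpha}$, then for all $k\ge 1$ $$f\left(x^{(k)}\right)-f^\star\le\frac{\|x_0-x^\star\|^2}{2kh}.$$
   Context: $\mathbb{R}^d$ carries the standard inner product $\langle\cdot,\cdot\rangle$ and Euclidean norm $\|\cdot\|$. Weak discrete gradient: a map $\overline{\nabla} f\colon\mathbb{R}^d\times\mathbb{R}^d\to\mathbb{R}^d$ is a weak discrete gradient of $f$ with parameters $(\alpha,\beta,\gamma)$, where $\alpha\ge 0$ and $\beta+\gamma\ge 0$ are real numbers, if for all $x,y,z\in\mathbb{R}^d$ $$f(y)-f(x)\le\langle\overline{\nabla} f(y,z),y-x\rangle+\alpha\|y-z\|^2-\beta\|z-x\|^2-\gamma\|y-x\|^2$$ and $\overline{\nabla} f(x,x)=\nabla f(x)$. Convention: $1/0=+\infty$, i.e. there is no step size restriction when $\alpha=0$. *)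

theory Defs
  imports "HOL-Analysis.Analysis"
begin

(* The consistency condition G x x = grad f x is expressed by GDERIV, which also entails that f is
   differentiable at x. *)
definition weak_discrete_gradient ::
  "('a::euclidean_space \<Rightarrow> real) \<Rightarrow> ('a \<Rightarrow> 'a \<Rightarrow> 'a) \<Rightarrow> real \<Rightarrow> real \<Rightarrow> real \<Rightarrow> bool"
where
  "weak_discrete_gradient f G \<alpha> \<beta> \<gamma> \<longleftrightarrow>
     \<alpha> \<ge> 0 \<and> \<beta> + \<gamma> \<ge> 0 \<and>
     (\<forall>x y z. f y - f x \<le> inner (G y z) (y - x) + \<alpha> * (norm (y - z))\<^sup>2
                 - \<beta> * (norm (z - x))\<^sup>2 - \<gamma> * (norm (y - x))\<^sup>2) \<and>
     (\<forall>x. GDERIV f x :> G x x)"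

(* Division of extended reals implements the convention 1/0 = infinity for step size bounds. *)
lemma step_size_bound_iff:
  assumes "\<alpha> \<ge> 0"
  shows "ereal h \<le> 1 / ereal (2 * \<alpha>) \<longleftrightarrow> \<alpha> = 0 \<or> h \<le> 1 / (2 * \<alpha>)"
  using assms
  by (cases "\<alpha> = 0")
     (simp_all add: one_ereal_def zero_ereal_def[symmetric] divide_ereal_def field_simps)

end

theory Submission
  imports Defs
begin

text \<open>
  By the polarization identity, one step from \<open>z\<close> to \<open>y\<close> satisfies
  \<open>2 h (f y - f w) \<le> |z - w|\<^sup>2 - |y - w|\<^sup>2\<close> for every \<open>w\<close>: the term
  \<open>\<alpha> |y - z|\<^sup>2\<close> is absorbed because \<open>2 \<alpha> h \<le> 1\<close>. Taking \<open>w = z\<close> shows that \<open>f\<close>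
  decreases along the iteration, and taking \<open>w\<close> to be the minimizer shows that
  \<open>2 k h (f (x k) - f w) + |x k - w|\<^sup>2\<close> does not increase with \<open>k\<close>.
\<close>

lemma weak_discrete_gradient_step:
  fixes f :: "'a::euclidean_space \<Rightarrow> real"
  assumes G: "weak_discrete_gradient f G \<alpha> \<beta> \<gamma>"
    and nonneg: "\<beta> \<ge> 0" "\<gamma> \<ge> 0"
    and h: "h > 0" "2 * \<alpha> * h \<le> 1"
    and step: "(y - z) /\<^sub>R h = - G y z"
  shows "2 * h * (f y - f w) \<le> (norm (z - w))\<^sup>2 - (norm (y - w))\<^sup>2"
proof -
  have "f y - f w \<le> inner (G y z) (y - w) + \<alpha> * (norm (y - z))\<^sup>2
          - \<beta> * (norm (z - w))\<^sup>2 - \<gamma> * (norm (y - w))\<^sup>2"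
    using G unfolding weak_discrete_gradient_def by blast
  moreover have "\<beta> * (norm (z - w))\<^sup>2 \<ge> 0" "\<gamma> * (norm (y - w))\<^sup>2 \<ge> 0"
    using nonneg by simp_all
  ultimately have "f y - f w \<le> inner (G y z) (y - w) + \<alpha> * (norm (y - z))\<^sup>2"
    by linarith
  then have "2 * h * (f y - f w) \<le> 2 * h * (inner (G y z) (y - w) + \<alpha> * (norm (y - z))\<^sup>2)"
    using h(1) by (intro mult_left_mono) auto
  also have "\<dots> = 2 * inner (h *\<^sub>R G y z) (y - w) + (2 * \<alpha> * h) * (norm (y - z))\<^sup>2"
    by (simp add: algebra_simps)
  \<comment> \<open>The update rule multiplied by \<open>h\<close> trades the discrete gradient for
    the displacement \<open>z - y\<close>.\<close>
  also have "h *\<^sub>R G y z = z - y"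
  proof -
    have "h *\<^sub>R ((y - z) /\<^sub>R h) = y - z"
      using h(1) by simp
    then show ?thesis
      unfolding step by (simp add: algebra_simps)
  qed
  also have "2 * inner (z - y) (y - w) + (2 * \<alpha> * h) * (norm (y - z))\<^sup>2
      \<le> 2 * inner (z - y) (y - w) + (norm (y - z))\<^sup>2"
    using mult_right_mono[OF h(2), of "(norm (y - z))\<^sup>2"] by simp
  \<comment> \<open>Expand the square of \<open>z - w = (z - y) + (y - w)\<close>.\<close>
  also have "\<dots> = (norm (z - w))\<^sup>2 - (norm (y - w))\<^sup>2"
    by (simp add: power2_norm_eq_inner inner_diff_left inner_diff_right inner_commute)
  finally show ?thesis .
qed

text \<open>A discrete Lyapunov argument: the weight \<open>k\<close> on the gap in \<open>f\<close>
  is what yields the rate \<open>1 / k\<close>.\<close>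

lemma weak_discrete_gradient_energy:
  fixes f :: "'a::euclidean_space \<Rightarrow> real"
  assumes G: "weak_discrete_gradient f G \<alpha> \<beta> \<gamma>"
    and nonneg: "\<beta> \<ge> 0" "\<gamma> \<ge> 0"
    and h: "h > 0" "2 * \<alpha> * h \<le> 1"
    and step: "\<And>k. (x (Suc k) - x k) /\<^sub>R h = - G (x (Suc k)) (x k)"
  shows "2 * real k * h * (f (x k) - f w) + (norm (x k - w))\<^sup>2 \<le> (norm (x 0 - w))\<^sup>2"
proof (induction k)
  case 0
  show ?case by simp
next
  case (Suc k)
  note one_step = weak_discrete_gradient_step[OF G nonneg h step[of k]]
  \<comment> \<open>With \<open>w = x k\<close> the bound of the one-step estimate is minus a
    square.\<close>
  have "2 * h * (f (x (Suc k)) - f (x k)) \<le> 0"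
    using order_trans[OF one_step[of "x k"], of 0] by simp
  then have "real k * (2 * h * (f (x (Suc k)) - f (x k))) \<le> 0"
    by (simp add: mult_nonneg_nonpos)
  \<comment> \<open>The energy changes by \<open>k\<close> times the decrease term just bounded,
    plus the one-step inequality at \<open>w\<close>.\<close>
  with one_step[of w] Suc show ?case
    by (simp add: algebra_simps)
qed

theorem theorem3p2:
  fixes f :: "real ^ 'd \<Rightarrow> real"
    and G :: "real ^ 'd \<Rightarrow> real ^ 'd \<Rightarrow> real ^ 'd"
    and xstar x0 :: "real ^ 'd"
    and x :: "nat \<Rightarrow> real ^ 'd"
    and fstar \<alpha> \<beta> \<gamma> h :: real
  assumes "f differentiable_on UNIV"
    and "convex_on UNIV f"
    and "\<forall>y. f xstar \<le> f y"
    and "f xstar = fstar"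
    and "weak_discrete_gradient f G \<alpha> \<beta> \<gamma>"
    and "\<beta> \<ge> 0"
    and "\<gamma> \<ge> 0"
    and "h > 0"
    and "x 0 = x0"
    and "\<forall>k. (x (Suc k) - x k) /\<^sub>R h = - G (x (Suc k)) (x k)"
    and "ereal h \<le> 1 / ereal (2 * \<alpha>)"
  shows "\<forall>k\<ge>1. f (x k) - fstar \<le> (norm (x0 - xstar))\<^sup>2 / (2 * real k * h)"
proof (intro allI impI)
  fix k :: nat
  assume "k \<ge> 1"
  have "\<alpha> \<ge> 0"
    using assms(5) by (simp add: weak_discrete_gradient_def)
  with assms(11) have "\<alpha> = 0 \<or> h \<le> 1 / (2 * \<alpha>)"
    by (simp only: step_size_bound_iff)
  \<comment> \<open>Clearing the denominator covers \<alpha> = 0 as well, where the left side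
    vanishes.\<close>
  with \<open>\<alpha> \<ge> 0\<close> have "2 * \<alpha> * h \<le> 1"
    by (cases "\<alpha> = 0") (simp_all add: field_simps)
  then have "2 * real k * h * (f (x k) - f xstar) + (norm (x k - xstar))\<^sup>2
      \<le> (norm (x 0 - xstar))\<^sup>2"
    using assms(10) by (intro weak_discrete_gradient_energy[OF assms(5-8)]) auto
  \<comment> \<open>Discard the squared distance from \<open>x k\<close> to the minimizer.\<close>
  then have "(f (x k) - fstar) * (2 * real k * h) \<le> (norm (x0 - xstar))\<^sup>2"
    unfolding assms(4,9) using zero_le_power2[of "norm (x k - xstar)"]
    by (simp only: mult.commute)
  with \<open>k \<ge> 1\<close> \<open>h > 0\<close> show "f (x k) - fstar \<le> (norm (x0 - xstar))\<^sup>2 / (2 * real k * h)"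
    by (subst pos_le_divide_eq) auto
qed

end
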